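(* Let $\kappa$ be an uncountable singular cardinal, and let $K$ be a $\kappa$-Corson compact space. Then $\pi\chi(x,K)<\kappa$ for every $x\in K$. Consequently, $K$ has strong tightness $\le\kappa$.
   Context: For an infinite cardinal $\kappa$ and a set $\Gamma$, $\Sigma_\kappa(\mathbb{R}^\Gamma)=\{x\in\mathbb{R}^\Gamma:\ |\{\gamma\in\Gamma:x(\gamma)\neq0\}|<\kappa\}$ with the topology inherited from the product. A compact (Hausdorff) space is $\kappa$-Corson compact if it is homeomorphic to a subset of $\Sigma_\kappa(\mathbb{R}^\Gamma)$ for some set $\Gamma$. $\pi\chi(x,K)$ is the $\pi$-character of $K$ at $x$, i.e. the minimal cardinality of a local $\pi$-base at $x$ (a family of nonempty open subsets of $K$ such that every neighborhood of $x$ contains a member of the family). The strong tightness of $K$ is $\le\tau$ if for every $X\subseteq K$ and $x\in\overline{X}$ there is $A\subseteq X$ such that $|A|<\tau$ and $x\in\overline{A}$. *)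

theory Defs
  imports "HOL-Analysis.Analysis"
begin

unbundle cardinal_syntax

text \<open>
  Cardinals are cardinal orders in the sense of the BNF cardinal theories. An infinite cardinal
  is singular if it is not \<^const>\<open>regularCard\<close>.
\<close>

definition Sigma_topology :: "'k rel \<Rightarrow> 'g set \<Rightarrow> ('g \<Rightarrow> real) topology" where
  "Sigma_topology \<kappa> \<Gamma> =
     subtopology (powertop_real \<Gamma>) {x. |{\<gamma> \<in> \<Gamma>. x \<gamma> \<noteq> 0}| <o \<kappa>}"

text \<open>
  HOL cannot quantify over types inside a definition, so the type from which the index
  set \<open>\<Gamma>\<close> is drawn is an explicit argument. Assuming this predicate for a free type variable
  \<open>'g\<close> covers index sets of every type.
\<close>

definition kappa_Corson_compact :: "'g itself \<Rightarrow> 'k rel \<Rightarrow> 'a topology \<Rightarrow> bool" where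
  "kappa_Corson_compact (_ :: 'g itself) \<kappa> K \<longleftrightarrow>
     compact_space K \<and> Hausdorff_space K \<and>
     (\<exists>(\<Gamma> :: 'g set) S. S \<subseteq> topspace (Sigma_topology \<kappa> \<Gamma>) \<and>
        K homeomorphic_space subtopology (Sigma_topology \<kappa> \<Gamma>) S)"

definition local_pi_base :: "'a topology \<Rightarrow> 'a \<Rightarrow> 'a set set \<Rightarrow> bool" where
  "local_pi_base K x \<B> \<longleftrightarrow>
     (\<forall>V \<in> \<B>. openin K V \<and> V \<noteq> {}) \<and>
     (\<forall>U. openin K U \<and> x \<in> U \<longrightarrow> (\<exists>V \<in> \<B>. V \<subseteq> U))"

text \<open>
  The minimum exists; see \<open>pi_character_attained\<close> and \<open>pi_character_least\<close> below.
\<close>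

definition pi_character :: "'a \<Rightarrow> 'a topology \<Rightarrow> 'a set rel" where
  "pi_character x K =
     (SOME r. r \<in> {|\<B>| |\<B>. local_pi_base K x \<B>} \<and>
              (\<forall>r' \<in> {|\<B>| |\<B>. local_pi_base K x \<B>}. r \<le>o r'))"

definition strong_tightness_le :: "'a topology \<Rightarrow> 'k rel \<Rightarrow> bool" where
  "strong_tightness_le K \<tau> \<longleftrightarrow>
     (\<forall>X x. X \<subseteq> topspace K \<and> x \<in> K closure_of X \<longrightarrow>
        (\<exists>A \<subseteq> X. |A| <o \<tau> \<and> x \<in> K closure_of A))"

lemma local_pi_base_all_open: "local_pi_base K x {V. openin K V \<and> V \<noteq> {}}"
  unfolding local_pi_base_def by blast

lemma pi_character_minimum:
  "pi_character x K \<in> {|\<B>| |\<B>. local_pi_base K x \<B>} \<and>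
   (\<forall>r' \<in> {|\<B>| |\<B>. local_pi_base K x \<B>}. pi_character x K \<le>o r')"
proof -
  define R where "R = {|\<B>| |\<B>. local_pi_base K x \<B>}"
  have "|{V. openin K V \<and> V \<noteq> {}}| \<in> R"
    unfolding R_def by (rule CollectI, rule exI, rule conjI[OF refl local_pi_base_all_open])
  then have "R \<noteq> {}"
    by (metis empty_iff)
  moreover have "\<forall>r \<in> R. Card_order r"
    by (auto simp: R_def card_of_Card_order)
  ultimately have "\<exists>r \<in> R. \<forall>r' \<in> R. r \<le>o r'"
    by (rule exists_minim_Card_order)
  then have "\<exists>r. r \<in> R \<and> (\<forall>r' \<in> R. r \<le>o r')"
    by (simp only: Bex_def)
  then show ?thesis
    unfolding pi_character_def R_def by (rule someI_ex)
qed

lemma pi_character_attained: "\<exists>\<B>. local_pi_base K x \<B> \<and> pi_character x K = |\<B>|"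
  using conjunct1[OF pi_character_minimum[of x K]] by auto

lemma pi_character_least:
  assumes "local_pi_base K x \<B>"
  shows "pi_character x K \<le>o |\<B>|"
proof (rule bspec[OF conjunct2[OF pi_character_minimum]])
  show "|\<B>| \<in> {|\<B>| |\<B>. local_pi_base K x \<B>}"
    by (rule CollectI, rule exI, rule conjI[OF refl assms])
qed

end

theory Submission
  imports Defs "HOL-Algebra.Free_Abelian_Groups"
begin

text \<open>
  Embed \<open>K\<close> by coordinates \<open>f \<gamma>\<close> and suppose that \<open>x\<close> has no local \<pi>-base of fewer than \<open>\<kappa>\<close> sets.
  Then the rational boxes over any set \<open>M\<close> of fewer than \<open>\<kappa>\<close> coordinates are not a local \<pi>-base, so
  there are a finite set \<open>A\<close> and \<open>n\<close> such that every point of \<open>K\<close> can be changed off \<open>M\<close> to one which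
  differs from \<open>x\<close> by at least \<open>1 / Suc n\<close> somewhere on \<open>A\<close>. Closing off over finite sets shows that,
  for each \<open>\<mu> < \<kappa>\<close>, a single finite set \<open>R\<close> serves as \<open>A \<inter> M\<close> for all \<open>M \<supseteq> R\<close> with at most \<open>\<mu>\<close> elements.
  Take such an \<open>R\<close> for each \<open>\<mu>\<close> in a cofinal set of size less than \<open>\<kappa>\<close> and keep the union of these
  fixed at \<open>x\<close>. Starting from \<open>x\<close> one can then go on making a point differ from \<open>x\<close> at a new
  coordinate, with limits by compactness, until it differs from \<open>x\<close> at \<open>\<kappa>\<close> coordinates, which
  contradicts the smallness of supports. For strong tightness at \<open>x\<close> in the closure of \<open>X\<close>, apply the
  result to this closure and pick a point of \<open>X\<close> in each member of a small local \<pi>-base.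
\<close>

section \<open>Compactness and cardinal arithmetic\<close>

lemma compact_space_indexed_fip:
  assumes "compact_space X"
    and "\<And>i. i \<in> I \<Longrightarrow> closedin X (C i)"
    and fin: "\<And>J. finite J \<Longrightarrow> J \<subseteq> I \<Longrightarrow> \<exists>z\<in>topspace X. \<forall>i\<in>J. z \<in> C i"
  shows "\<exists>z\<in>topspace X. \<forall>i\<in>I. z \<in> C i"
proof -
  have *: "compactin X (topspace X)"
    using assms(1) by (simp add: compact_space_def)
  have "topspace X \<inter> \<Inter>(C ` I) \<noteq> {}"
  proof (rule conjunct2[OF *[unfolded compactin_fip], rule_format], intro conjI ballI allI impI)
    show "closedin X S" if "S \<in> C ` I" for S
      using that assms(2) by blast
    fix \<F> assume "finite \<F> \<and> \<F> \<subseteq> C ` I"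
    then obtain J where J: "finite J" "J \<subseteq> I" "\<F> = C ` J"
      by (meson finite_subset_image)
    with fin[OF J(1,2)] show "topspace X \<inter> \<Inter>\<F> \<noteq> {}"
      by auto
  qed
  then show ?thesis by blast
qed

lemma uncountable_Card_order_infinite_Field:
  assumes "natLeq <o r"
  shows "\<not> finite (Field r)"
proof
  assume "finite (Field r)"
  then have "r <o natLeq"
    using assms finite_ordLess_infinite[of r natLeq]
    by (metis Field_natLeq infinite_UNIV_nat ordLess_Well_order_simp)
  with assms show False
    using not_ordLess_ordLeq ordLess_imp_ordLeq by blast
qed

lemma card_of_Fpow_ordLeq:
  assumes "infinite T" "|X| \<le>o |T|"
  shows "|Fpow X| \<le>o |T|"
proof (cases "finite X")
  case True
  then have "finite (Fpow X)"
    by (simp add: Fpow_Pow_finite)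
  then show ?thesis
    using assms(1) card_of_ordLeq_infinite card_of_ordLeq_finite ordLess_imp_ordLeq
    by (metis card_of_Well_order ordLess_or_ordLeq)
next
  case False
  then show ?thesis
    using assms(2) card_of_Fpow_infinite ordIso_ordLeq_trans by blast
qed

text \<open>The initial segments \<open>underS \<kappa> c\<close> over a short cofinal set dominate
  all cardinals below \<open>\<kappa>\<close>: a set smaller than \<open>\<kappa>\<close> is
  isomorphic to the segment below some \<open>a\<close>, and any \<open>c\<close> of the cofinal set
  above \<open>a\<close> has a segment containing that one.\<close>

lemma singular_short_cofinal:
  fixes \<kappa> :: "'k rel"
  assumes "Card_order \<kappa>" "\<not> regularCard \<kappa>"
  obtains C where "C \<subseteq> Field \<kappa>" "|C| <o \<kappa>"
    "\<And>M :: 'b set. |M| <o \<kappa> \<Longrightarrow> \<exists>c\<in>C. |M| \<le>o |underS \<kappa> c|"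
proof -
  have wo: "Well_order \<kappa>"
    using assms(1) by (rule card_order_on_well_order_on)
  obtain C where C: "C \<subseteq> Field \<kappa>" "cofinal C \<kappa>" "\<not> |C| =o \<kappa>"
    using assms(2) unfolding regularCard_def by blast
  have "|C| \<le>o \<kappa>"
    using card_of_mono1[OF C(1)] assms(1) card_of_Field_ordIso ordLeq_ordIso_trans by blast
  then have "|C| <o \<kappa>"
    using C(3) ordLeq_iff_ordLess_or_ordIso by blast
  moreover have "\<exists>c\<in>C. |M| \<le>o |underS \<kappa> c|" if M: "|M| <o \<kappa>" for M :: "'b set"
  proof -
    obtain a where a: "a \<in> Field \<kappa>" "|M| =o Restr \<kappa> (underS \<kappa> a)"
      using M ordLess_iff_ordIso_Restr[OF wo card_of_Well_order] by blast
    obtain c where c: "c \<in> C" "a \<noteq> c" "(a, c) \<in> \<kappa>"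
      using bspec[OF C(2)[unfolded cofinal_def] a(1)] by auto
    have "trans \<kappa>" "antisym \<kappa>"
      using wo by (simp_all add: order_on_defs)
    then have "underS \<kappa> a \<subseteq> underS \<kappa> c"
      using c(3) by (rule underS_incr)
    moreover have "Field (Restr \<kappa> (underS \<kappa> a)) \<subseteq> underS \<kappa> a"
      unfolding Field_def by auto
    ultimately have "|Field (Restr \<kappa> (underS \<kappa> a))| \<le>o |underS \<kappa> c|"
      using card_of_mono1 subset_trans by metis
    with card_of_cong[OF a(2)] have "|M| \<le>o |underS \<kappa> c|"
      unfolding Field_card_of by (rule ordIso_ordLeq_trans)
    with c show ?thesis by blast
  qed
  ultimately show ?thesis
    using that C(1) by blast
qed

section \<open>Compact spaces with coordinates of small support\<close>

locale small_support_coordinates =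
  fixes K :: "'a topology" and f :: "'g \<Rightarrow> 'a \<Rightarrow> real" and \<kappa> :: "'k rel"
  assumes compact: "compact_space K"
    and cont: "continuous_map K euclideanreal (f \<gamma>)"
    and separating: "y \<in> topspace K \<Longrightarrow> z \<in> topspace K \<Longrightarrow> (\<And>\<gamma>. f \<gamma> y = f \<gamma> z) \<Longrightarrow> y = z"
    and Card: "Card_order \<kappa>"
    and uncountable: "natLeq <o \<kappa>"
    and support: "y \<in> topspace K \<Longrightarrow> |{\<gamma>. f \<gamma> y \<noteq> 0}| <o \<kappa>"
begin

text \<open>Finitely many constraints with rational endpoints keep the number of boxes below
  \<open>\<kappa>\<close> when \<open>M\<close> is. The empty box is removed because members of a
  local pi-base are nonempty.\<close>

definition boxes :: "'g set \<Rightarrow> 'a set set" where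
  "boxes M = (\<lambda>E. {y \<in> topspace K. \<forall>(\<gamma>, a, b)\<in>E. a < f \<gamma> y \<and> f \<gamma> y < b}) `
     Fpow (M \<times> (\<rat> \<times> \<rat>)) - {{}}"

definition escapes :: "'a \<Rightarrow> 'g set \<Rightarrow> nat \<Rightarrow> 'g set \<Rightarrow> bool" where
  "escapes x A n M \<longleftrightarrow> (\<forall>z\<in>topspace K. \<exists>y\<in>topspace K.
     (\<forall>\<gamma>\<in>M. f \<gamma> y = f \<gamma> z) \<and> (\<exists>\<gamma>\<in>A. 1 / real (Suc n) \<le> \<bar>f \<gamma> y - f \<gamma> x\<bar>))"

text \<open>
  Enlarging \<open>M\<close> makes escaping harder, so \<open>R\<close> remains a root of the subsets that contain it; see
  \<open>root_antimono\<close>. This is the reason for tracking \<open>A \<inter> M\<close> instead of \<open>A\<close>.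
\<close>
definition root :: "'a \<Rightarrow> 'g set \<Rightarrow> nat \<Rightarrow> 'g set \<Rightarrow> bool" where
  "root x R n M \<longleftrightarrow> (\<exists>A. finite A \<and> A \<inter> M = R \<and> escapes x A n M)"

lemma infinite_kappa: "\<not> finite (Field \<kappa>)"
  using uncountable by (rule uncountable_Card_order_infinite_Field)

lemma Plus_nat_less: "|M| <o \<kappa> \<Longrightarrow> |M <+> (UNIV :: nat set)| <o \<kappa>"
  using card_of_Plus_ordLess_infinite_Field[OF infinite_kappa Card, of M "UNIV :: nat set"]
    uncountable card_of_nat ordIso_ordLess_trans by blast

lemma card_of_boxes:
  assumes "|M| <o \<kappa>"
  shows "|boxes M| <o \<kappa>"
proof -
  \<comment> \<open>\<open>M\<close> may be finite; adding a copy of the naturals gives an infinite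
    set, still smaller than the uncountable \<open>\<kappa>\<close>.\<close>
  define T where "T = M <+> (UNIV :: nat set)"
  have T: "infinite T" "|T| <o \<kappa>"
    using Plus_nat_less[OF assms] by (auto simp: T_def finite_Plus_iff)
  have c: "countable (\<rat> \<times> \<rat> :: (real \<times> real) set)"
    by (simp add: countable_rat)
  have "|\<rat> \<times> \<rat> :: (real \<times> real) set| \<le>o |UNIV :: nat set|"
    using c unfolding countable_def by (meson card_of_ordLeq subset_UNIV)
  also have "|UNIV :: nat set| \<le>o |T|"
    by (simp add: T_def card_of_Plus2)
  finally have "|M \<times> (\<rat> \<times> \<rat> :: (real \<times> real) set)| \<le>o |T|"
    using card_of_Times_ordLeq_infinite_Field[of "|T|" M "\<rat> \<times> \<rat> :: (real \<times> real) set"] T(1)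
    by (simp add: T_def card_of_Plus1 card_of_Card_order Field_card_of)
  then have "|Fpow (M \<times> (\<rat> \<times> \<rat> :: (real \<times> real) set))| \<le>o |T|"
    by (rule card_of_Fpow_ordLeq[OF T(1)])
  moreover have "|boxes M| \<le>o |Fpow (M \<times> (\<rat> \<times> \<rat> :: (real \<times> real) set))|"
    unfolding boxes_def by (meson Diff_subset card_of_image card_of_mono1 ordLeq_transitive)
  ultimately show ?thesis
    using T(2) ordLeq_ordLess_trans ordLeq_transitive by blast
qed

lemma openin_box:
  assumes "finite E"
  shows "openin K {y \<in> topspace K. \<forall>(\<gamma>, a, b)\<in>E. a < f \<gamma> y \<and> f \<gamma> y < b}"
proof -
  have "openin K {y \<in> topspace K. f \<gamma> y \<in> {a<..<b}}" for \<gamma> a b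
    using openin_continuous_map_preimage[OF cont[of \<gamma>], of "{a<..<b}"] by simp
  then have "openin K {y \<in> topspace K. a < f \<gamma> y \<and> f \<gamma> y < b}" for \<gamma> a b
    by simp
  then have "openin K (topspace K \<inter> \<Inter>((\<lambda>(\<gamma>, a, b). {y \<in> topspace K. a < f \<gamma> y \<and> f \<gamma> y < b}) ` E))"
    using assms by (intro openin_Int_Inter) auto
  moreover have "topspace K \<inter> \<Inter>((\<lambda>(\<gamma>, a, b). {y \<in> topspace K. a < f \<gamma> y \<and> f \<gamma> y < b}) ` E) =
      {y \<in> topspace K. \<forall>(\<gamma>, a, b)\<in>E. a < f \<gamma> y \<and> f \<gamma> y < b}"
    by (auto; force)
  ultimately show ?thesis by simp
qed

lemma closedin_coordinate: "closed S \<Longrightarrow> closedin K {y \<in> topspace K. f \<gamma> y \<in> S}"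
  using closedin_continuous_map_preimage[OF cont[of \<gamma>], of S] by simp

lemma closedin_far: "closedin K {y \<in> topspace K. r \<le> \<bar>f \<gamma> y - c\<bar>}"
proof -
  have "{t :: real. r \<le> \<bar>t - c\<bar>} = {c + r..} \<union> {..c - r}"
    by auto
  then have "closed {t :: real. r \<le> \<bar>t - c\<bar>}"
    by (simp add: closed_Un)
  from closedin_coordinate[OF this, of \<gamma>] show ?thesis by simp
qed

lemma closedin_near: "closedin K {y \<in> topspace K. \<bar>f \<gamma> y - c\<bar> \<le> r}"
proof -
  have "{t :: real. \<bar>t - c\<bar> \<le> r} = {c - r..c + r}"
    by auto
  then have "closed {t :: real. \<bar>t - c\<bar> \<le> r}"
    by simp
  from closedin_coordinate[OF this, of \<gamma>] show ?thesis by simp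
qed

text \<open>The coordinates are only assumed continuous and separating; compactness makes them
  determine the topology. If no basic neighbourhood fits into \<open>U\<close>, some point outside
  \<open>U\<close> agrees with \<open>x\<close> in every coordinate, so it is
  \<open>x\<close>.\<close>

lemma standard_nbhd:
  assumes "openin K U" "x \<in> U"
  shows "\<exists>A n. finite A \<and>
    (\<forall>y\<in>topspace K. (\<forall>\<gamma>\<in>A. \<bar>f \<gamma> y - f \<gamma> x\<bar> < 1 / real (Suc n)) \<longrightarrow> y \<in> U)"
proof (rule ccontr)
  assume neg: "\<not> ?thesis"
  define C where "C = (\<lambda>(\<gamma>, n). (topspace K - U) \<inter>
    {y \<in> topspace K. \<bar>f \<gamma> y - f \<gamma> x\<bar> \<le> 1 / real (Suc n)})"
  have "\<exists>z\<in>topspace K. \<forall>i\<in>UNIV. z \<in> C i"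
  proof (rule compact_space_indexed_fip[OF compact])
    show "closedin K (C i)" for i
      unfolding C_def split_beta
      using assms(1) closedin_near by (intro closedin_Int) auto
    fix J :: "('g \<times> nat) set" assume J: "finite J"
    obtain n where n: "\<forall>m\<in>snd ` J. m \<le> n"
      using finite_nat_set_iff_bounded_le finite_imageI[OF J] by blast
    obtain y where y: "y \<in> topspace K" "y \<notin> U"
      "\<forall>\<gamma>\<in>fst ` J. \<bar>f \<gamma> y - f \<gamma> x\<bar> < 1 / real (Suc n)"
      using neg finite_imageI[OF J] by blast
    have "y \<in> C (\<gamma>, m)" if "(\<gamma>, m) \<in> J" for \<gamma> m
    proof -
      have "m \<le> n" "\<bar>f \<gamma> y - f \<gamma> x\<bar> < 1 / real (Suc n)"
        using n y(3) that by force+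
      moreover have "1 / real (Suc n) \<le> 1 / real (Suc m)"
        using \<open>m \<le> n\<close> by (intro divide_left_mono) auto
      ultimately show ?thesis
        using y by (simp add: C_def)
    qed
    with y(1) show "\<exists>z\<in>topspace K. \<forall>i\<in>J. z \<in> C i"
      by (metis surj_pair)
  qed
  then obtain z where z: "z \<in> topspace K" "z \<in> C i" for i
    by blast
  have "f \<gamma> z = f \<gamma> x" for \<gamma>
  proof (rule ccontr)
    assume "f \<gamma> z \<noteq> f \<gamma> x"
    then obtain n where "1 / real (Suc n) < \<bar>f \<gamma> z - f \<gamma> x\<bar>"
      using nat_approx_posE[of "\<bar>f \<gamma> z - f \<gamma> x\<bar>"] by auto
    with z(2)[of "(\<gamma>, n)"] show False
      by (simp add: C_def)
  qed
  moreover have "x \<in> topspace K"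
    using assms openin_subset by blast
  ultimately have "z = x"
    using separating z(1) by blast
  \<comment> \<open>Every \<open>C i\<close> lies outside \<open>U\<close>, so an arbitrary index
    will do.\<close>
  with z(2)[of undefined] assms(2) show False
    by (auto simp: C_def split: prod.splits)
qed

section \<open>Escaping points and their finite roots\<close>

text \<open>\<open>A\<close> and \<open>n\<close> come from one neighbourhood of \<open>x\<close>
  that contains no box, hence do not depend on \<open>z\<close>. Each box around \<open>z\<close>
  has a point outside that neighbourhood; shrinking the boxes gives, by compactness, a point that
  agrees with \<open>z\<close> on all of \<open>M\<close>.\<close>

lemma escapes_exists:
  assumes x: "x \<in> topspace K" and no_base: "\<not> local_pi_base K x (boxes M)"
  shows "\<exists>A n. finite A \<and> escapes x A n M"
proof -
  have "openin K V \<and> V \<noteq> {}" if "V \<in> boxes M" for V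
    using that openin_box by (auto simp: boxes_def Fpow_def)
  then obtain U where U: "openin K U" "x \<in> U" "\<And>V. V \<in> boxes M \<Longrightarrow> \<not> V \<subseteq> U"
    using no_base unfolding local_pi_base_def by blast
  obtain A n where A: "finite A"
    "\<And>y. y \<in> topspace K \<Longrightarrow> \<forall>\<gamma>\<in>A. \<bar>f \<gamma> y - f \<gamma> x\<bar> < 1 / real (Suc n) \<Longrightarrow> y \<in> U"
    using standard_nbhd[OF U(1,2)] by blast
  have "\<exists>y\<in>topspace K. (\<forall>\<gamma>\<in>M. f \<gamma> y = f \<gamma> z) \<and>
      (\<exists>\<gamma>\<in>A. 1 / real (Suc n) \<le> \<bar>f \<gamma> y - f \<gamma> x\<bar>)" if z: "z \<in> topspace K" for z
  proof -
    define I where "I = {(\<gamma>, a, b). \<gamma> \<in> M \<and> a \<in> \<rat> \<and> b \<in> \<rat> \<and> a < f \<gamma> z \<and> f \<gamma> z < b}"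
    define far where "far = (\<Union>\<gamma>\<in>A. {y \<in> topspace K. 1 / real (Suc n) \<le> \<bar>f \<gamma> y - f \<gamma> x\<bar>})"
    \<comment> \<open>Closed intervals are used for compactness. Finitely many of them are handled
      by the corresponding open box, which contains \<open>z\<close> and so is nonempty.\<close>
    define C where "C = (\<lambda>i. case i of None \<Rightarrow> far
      | Some (\<gamma>, a, b) \<Rightarrow> {y \<in> topspace K. f \<gamma> y \<in> {a..b}})"
    have "\<exists>y\<in>topspace K. \<forall>i\<in>insert None (Some ` I). y \<in> C i"
    proof (rule compact_space_indexed_fip[OF compact])
      fix i
      have "closedin K far"
        unfolding far_def using A(1) closedin_far by (intro closedin_Union) auto
      moreover have "closedin K {y \<in> topspace K. f \<gamma> y \<in> {a..b}}" for \<gamma> a b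
        by (rule closedin_coordinate) simp
      ultimately show "closedin K (C i)"
        unfolding C_def by (cases i) (auto simp only: option.case split: prod.splits)
    next
      fix J assume J: "finite J" "J \<subseteq> insert None (Some ` I)"
      define E where "E = Some -` J"
      define V where "V = {y \<in> topspace K. \<forall>(\<gamma>, a, b)\<in>E. a < f \<gamma> y \<and> f \<gamma> y < b}"
      have "finite E"
        unfolding E_def using J(1) by (simp add: finite_vimageI)
      have "E \<subseteq> I"
        using J(2) by (auto simp: E_def)
      then have "E \<in> Fpow (M \<times> (\<rat> \<times> \<rat>))" "z \<in> V"
        using \<open>finite E\<close> z by (auto simp: I_def Fpow_def V_def)
      then have "V \<in> boxes M"
        unfolding boxes_def V_def by blast
      then obtain y where y: "y \<in> V" "y \<notin> U"
        using U(3) by blast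
      then have "y \<in> far"
        using A(2)[of y] by (force simp: V_def far_def)
      moreover have "y \<in> C (Some e)" if "Some e \<in> J" for e
      proof -
        have "e \<in> E"
          using that by (simp add: E_def)
        with y(1) show ?thesis
          by (cases e) (auto simp: V_def C_def)
      qed
      ultimately have "y \<in> C i" if "i \<in> J" for i
        using that by (cases i) (simp_all add: C_def)
      then show "\<exists>y\<in>topspace K. \<forall>i\<in>J. y \<in> C i"
        using y(1) by (auto simp: V_def)
    qed
    then obtain y where y: "y \<in> topspace K" "y \<in> C None" "\<And>e. e \<in> I \<Longrightarrow> y \<in> C (Some e)"
      by auto
    have "f \<gamma> y = f \<gamma> z" if \<gamma>: "\<gamma> \<in> M" for \<gamma>
    proof (rule ccontr)
      assume "f \<gamma> y \<noteq> f \<gamma> z"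
      then consider "f \<gamma> y < f \<gamma> z" | "f \<gamma> z < f \<gamma> y" by linarith
      then obtain a b where "a \<in> \<rat>" "b \<in> \<rat>" "a < f \<gamma> z" "f \<gamma> z < b" "f \<gamma> y \<notin> {a..b}"
      proof cases
        case 1
        then obtain a where "a \<in> \<rat>" "f \<gamma> y < a" "a < f \<gamma> z"
          using Rats_dense_in_real by blast
        moreover obtain b where "b \<in> \<rat>" "f \<gamma> z < b"
          using Rats_dense_in_real[of "f \<gamma> z" "f \<gamma> z + 1"] by auto
        ultimately show ?thesis using that by auto
      next
        case 2
        then obtain b where "b \<in> \<rat>" "f \<gamma> z < b" "b < f \<gamma> y"
          using Rats_dense_in_real by blast
        moreover obtain a where "a \<in> \<rat>" "a < f \<gamma> z"
          using Rats_dense_in_real[of "f \<gamma> z - 1" "f \<gamma> z"] by auto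
        ultimately show ?thesis using that by auto
      qed
      with y(3)[of "(\<gamma>, a, b)"] \<gamma> show False
        by (auto simp: I_def C_def)
    qed
    with y(1,2) show ?thesis
      by (auto simp: C_def far_def)
  qed
  with A(1) show ?thesis
    unfolding escapes_def by blast
qed

lemma root_antimono:
  assumes "root x R n M'" "R \<subseteq> M" "M \<subseteq> M'"
  shows "root x R n M"
proof -
  obtain A where A: "finite A" "A \<inter> M' = R" "escapes x A n M'"
    using assms(1) unfolding root_def by blast
  have "escapes x A n M"
    using A(3) assms(3) unfolding escapes_def by (meson subsetD)
  moreover have "A \<inter> M = R"
    using A(2) assms by blast
  ultimately show ?thesis
    using A(1) unfolding root_def by blast
qed

text \<open>Otherwise each finite \<open>R\<close> and each \<open>n\<close> have a bad set
  \<open>m R n\<close>. Close the empty set off under \<open>m\<close> to obtain \<open>M\<close>,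
  still of size at most that of \<open>T\<close>. The root \<open>R\<close> that \<open>M\<close>
  has is finite, so \<open>m R n\<close> lies inside \<open>M\<close>, and
  \<open>root_antimono\<close> makes \<open>R\<close> a root of the bad set.\<close>

lemma uniform_root:
  fixes T :: "'t set"
  assumes esc: "\<forall>M. |M| <o \<kappa> \<longrightarrow> (\<exists>A n. finite A \<and> escapes x A n M)"
    and T: "infinite T" "|T| <o \<kappa>"
  shows "\<exists>R n. finite R \<and> (\<forall>M. R \<subseteq> M \<longrightarrow> |M| \<le>o |T| \<longrightarrow> root x R n M)"
proof (rule ccontr)
  assume "\<not> ?thesis"
  then have "\<exists>M. finite R \<longrightarrow> R \<subseteq> M \<and> |M| \<le>o |T| \<and> \<not> root x R n M" for R n
    by blast
  then obtain m where m: "\<And>R n. finite R \<Longrightarrow> R \<subseteq> m R n \<and> |m R n| \<le>o |T| \<and> \<not> root x R n (m R n)"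
    by metis
  define next_set where "next_set M = M \<union> (\<Union>(R, n)\<in>Fpow M \<times> UNIV. m R n)" for M
  \<comment> \<open>Since \<open>m\<close> is applied to finite sets only, countably many rounds
    reach a closed set.\<close>
  define Ms where "Ms k = (next_set ^^ k) {}" for k
  define M where "M = (\<Union>k. Ms k)"
  have nat: "|UNIV :: nat set| \<le>o |T|"
    using T(1) infinite_iff_card_of_nat by blast
  have fT: "\<not> finite (Field |T| )"
    using T(1) by (simp add: Field_card_of)
  have "|next_set L| \<le>o |T|" if L: "|L| \<le>o |T|" for L
  proof -
    have "|Fpow L \<times> (UNIV :: nat set)| \<le>o |T|"
      using card_of_Times_ordLeq_infinite_Field[OF fT] card_of_Fpow_ordLeq[OF T(1) L] nat
        card_of_Card_order by blast
    moreover have "\<forall>i\<in>Fpow L \<times> UNIV. |case i of (R, n) \<Rightarrow> m R n| \<le>o |T|"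
      using m by (auto simp: Fpow_def)
    ultimately have "|\<Union>(R, n)\<in>Fpow L \<times> UNIV. m R n| \<le>o |T|"
      by (rule card_of_UNION_ordLeq_infinite[OF T(1)])
    then show ?thesis
      unfolding next_set_def
      using card_of_Un_ordLeq_infinite_Field[OF fT L] card_of_Card_order by blast
  qed
  then have "|Ms k| \<le>o |T|" for k
    by (induction k) (auto simp: Ms_def card_of_empty)
  then have "|M| \<le>o |T|"
    unfolding M_def using card_of_UNION_ordLeq_infinite[OF T(1) nat] by blast
  then obtain A n where A: "finite A" "escapes x A n M"
    using esc T(2) ordLeq_ordLess_trans by blast
  define R where "R = A \<inter> M"
  have R: "finite R" "R \<subseteq> M" "root x R n M"
    using A by (auto simp: R_def root_def)
  have step: "Ms (Suc k) = next_set (Ms k)" for k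
    by (simp add: Ms_def)
  have "mono Ms"
    by (rule monoI, rule lift_Suc_mono_le) (auto simp: step next_set_def)
  have "\<exists>k. R \<subseteq> Ms k"
    using R(1,2)
  proof (induction R rule: finite_induct)
    case (insert a F)
    then obtain k l where "F \<subseteq> Ms k" "a \<in> Ms l"
      by (auto simp: M_def)
    then have "insert a F \<subseteq> Ms (max k l)"
      using monoD[OF \<open>mono Ms\<close>, of k "max k l"] monoD[OF \<open>mono Ms\<close>, of l "max k l"] by auto
    then show ?case by blast
  qed simp
  then obtain k where "R \<subseteq> Ms k" ..
  then have "m R n \<subseteq> Ms (Suc k)"
    using R(1) by (auto simp: step next_set_def Fpow_def)
  then have "m R n \<subseteq> M"
    by (auto simp: M_def)
  then show False
    using root_antimono[OF R(3)] m[OF R(1)] by blast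
qed

text \<open>
  Here singularity enters: \<open>N\<close> collects one finite uniform root for each member of a short cofinal
  set, so it has fewer than \<open>\<kappa>\<close> elements and contains, for every small \<open>M\<close>, a root of \<open>M\<close>. A point
  that agrees with \<open>x\<close> on \<open>N\<close> can then only escape at a coordinate outside \<open>M\<close>.
\<close>
lemma new_coordinate:
  assumes sing: "\<not> regularCard \<kappa>"
    and esc: "\<forall>M. |M| <o \<kappa> \<longrightarrow> (\<exists>A n. finite A \<and> escapes x A n M)"
  shows "\<exists>N. |N| <o \<kappa> \<and> (\<forall>M z. |M| <o \<kappa> \<longrightarrow> N \<subseteq> M \<longrightarrow> z \<in> topspace K \<longrightarrow>
    (\<forall>\<gamma>\<in>N. f \<gamma> z = f \<gamma> x) \<longrightarrow>
    (\<exists>y\<in>topspace K. \<exists>\<gamma> n. (\<forall>\<delta>\<in>M. f \<delta> y = f \<delta> z) \<and> \<gamma> \<notin> M \<and>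
      1 / real (Suc n) \<le> \<bar>f \<gamma> y - f \<gamma> x\<bar>))"
proof -
  obtain C where C: "C \<subseteq> Field \<kappa>" "|C| <o \<kappa>"
    "\<And>M :: 'g set. |M| <o \<kappa> \<Longrightarrow> \<exists>c\<in>C. |M| \<le>o |underS \<kappa> c|"
    using singular_short_cofinal[OF Card sing] by metis
  define T where "T c = underS \<kappa> c <+> (UNIV :: nat set)" for c
  have "\<exists>R n. finite R \<and> (\<forall>M. R \<subseteq> M \<longrightarrow> |M| \<le>o |T c| \<longrightarrow> root x R n M)" if "c \<in> C" for c
  proof (rule uniform_root[OF esc])
    show "infinite (T c)"
      by (auto simp: T_def finite_Plus_iff)
    show "|T c| <o \<kappa>"
      unfolding T_def using that C(1) card_of_underS[OF Card] Plus_nat_less by blast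
  qed
  then obtain R n where R: "\<And>c. c \<in> C \<Longrightarrow> finite (R c)"
    "\<And>c M. c \<in> C \<Longrightarrow> R c \<subseteq> M \<Longrightarrow> |M| \<le>o |T c| \<Longrightarrow> root x (R c) (n c) M"
    by metis
  show ?thesis
  proof (intro exI[of _ "\<Union>c\<in>C. R c"] conjI allI impI)
    define P where "P = C <+> (UNIV :: nat set)"
    have P: "infinite P" "|P| <o \<kappa>"
      using Plus_nat_less[OF C(2)] by (auto simp: P_def finite_Plus_iff)
    have "|R c| \<le>o |P|" if "c \<in> C" for c
      using R(1)[OF that] P(1)
      by (metis card_of_Well_order card_of_ordLeq_finite ordLess_imp_ordLeq ordLess_or_ordLeq)
    moreover have "|C| \<le>o |P|"
      by (simp add: P_def card_of_Plus1)
    ultimately have "|\<Union>c\<in>C. R c| \<le>o |P|"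
      using card_of_UNION_ordLeq_infinite[OF P(1)] by blast
    then show "|\<Union>c\<in>C. R c| <o \<kappa>"
      using P(2) ordLeq_ordLess_trans by blast
  next
    fix M z
    assume M: "|M| <o \<kappa>" "(\<Union>c\<in>C. R c) \<subseteq> M" and z: "z \<in> topspace K" "\<forall>\<gamma>\<in>\<Union>c\<in>C. R c. f \<gamma> z = f \<gamma> x"
    obtain c where c: "c \<in> C" "|M| \<le>o |underS \<kappa> c|"
      using C(3)[OF M(1)] by blast
    have "|M| \<le>o |T c|"
      unfolding T_def using c(2) card_of_Plus1 ordLeq_transitive by blast
    moreover have "R c \<subseteq> M"
      using M(2) c(1) by blast
    ultimately have "root x (R c) (n c) M"
      using R(2)[OF c(1)] by blast
    then obtain A where A: "A \<inter> M = R c" "escapes x A (n c) M"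
      unfolding root_def by blast
    obtain y \<gamma> where y: "y \<in> topspace K" "\<forall>\<delta>\<in>M. f \<delta> y = f \<delta> z" "\<gamma> \<in> A"
      "1 / real (Suc (n c)) \<le> \<bar>f \<gamma> y - f \<gamma> x\<bar>"
      using A(2) z(1) unfolding escapes_def by blast
    \<comment> \<open>Inside \<open>M\<close> the coordinate would belong to \<open>R c\<close>,
      where \<open>y\<close> agrees with \<open>z\<close> and \<open>z\<close> with
      \<open>x\<close>.\<close>
    have "\<gamma> \<notin> M"
    proof
      assume "\<gamma> \<in> M"
      with y(3) A(1) have "\<gamma> \<in> R c" by blast
      with z(2) c(1) y(2) \<open>\<gamma> \<in> M\<close> have "f \<gamma> y = f \<gamma> x" by auto
      moreover have "0 < 1 / real (Suc (n c))"
        by simp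
      ultimately show False
        using y(4) by linarith
    qed
    with y show "\<exists>y\<in>topspace K. \<exists>\<gamma> n. (\<forall>\<delta>\<in>M. f \<delta> y = f \<delta> z) \<and> \<gamma> \<notin> M \<and>
        1 / real (Suc n) \<le> \<bar>f \<gamma> y - f \<gamma> x\<bar>"
      by blast
  qed
qed

section \<open>Small local pi-bases by maximality\<close>

text \<open>Zorn's lemma replaces the transfinite construction. A maximal set \<open>D\<close> of
  demands met by one point involves fewer than \<open>\<kappa>\<close> coordinates, since supports
  are small; \<open>new_coordinate\<close> then adds a further demand.\<close>

lemma small_local_pi_base:
  assumes sing: "\<not> regularCard \<kappa>" and x: "x \<in> topspace K"
  shows "\<exists>\<B>. local_pi_base K x \<B> \<and> |\<B>| <o \<kappa>"
proof (rule ccontr)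
  assume neg: "\<not> ?thesis"
  have "\<forall>M. |M| <o \<kappa> \<longrightarrow> (\<exists>A n. finite A \<and> escapes x A n M)"
    using escapes_exists[OF x] neg card_of_boxes by blast
  from new_coordinate[OF sing this] obtain N where N: "|N| <o \<kappa>"
    "\<forall>M z. |M| <o \<kappa> \<longrightarrow> N \<subseteq> M \<longrightarrow> z \<in> topspace K \<longrightarrow> (\<forall>\<gamma>\<in>N. f \<gamma> z = f \<gamma> x) \<longrightarrow>
      (\<exists>y\<in>topspace K. \<exists>\<gamma> n. (\<forall>\<delta>\<in>M. f \<delta> y = f \<delta> z) \<and> \<gamma> \<notin> M \<and>
        1 / real (Suc n) \<le> \<bar>f \<gamma> y - f \<gamma> x\<bar>)"
    by (elim exE conjE)
  \<comment> \<open>Recording \<open>n\<close> together with the coordinate turns "differs from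
    \<open>x\<close>" into a closed condition, which survives the passage to unions of
    chains.\<close>
  define far where "far D z \<longleftrightarrow> z \<in> topspace K \<and> (\<forall>\<gamma>\<in>N. f \<gamma> z = f \<gamma> x) \<and>
    (\<forall>(\<gamma>, n)\<in>D. 1 / real (Suc n) \<le> \<bar>f \<gamma> z - f \<gamma> x\<bar>)" for D :: "('g \<times> nat) set" and z
  define \<D> where "\<D> = {D. \<exists>z. far D z}"
  have "\<exists>D\<in>\<D>. \<forall>X\<in>\<D>. D \<subseteq> X \<longrightarrow> X = D"
  proof (rule subset_Zorn_nonempty)
    have "{} \<in> \<D>"
      using x by (auto simp: \<D>_def far_def)
    then show "\<D> \<noteq> {}" by blast
    fix \<C> assume \<C>: "\<C> \<noteq> {}" "subset.chain \<D> \<C>"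
    have "\<exists>z\<in>topspace K. \<forall>D\<in>\<C>. z \<in> {z. far D z}"
    proof (rule compact_space_indexed_fip[OF compact])
      fix D
      have "closedin K (topspace K \<inter> \<Inter>((\<lambda>\<gamma>. {y \<in> topspace K. f \<gamma> y \<in> {f \<gamma> x}}) ` N \<union>
          (\<lambda>(\<gamma>, n). {y \<in> topspace K. 1 / real (Suc n) \<le> \<bar>f \<gamma> y - f \<gamma> x\<bar>}) ` D))"
        using closedin_far closedin_coordinate[of "{_}"]
        by (cases "N = {} \<and> D = {}") (auto intro!: closedin_Int closedin_Inter)
      also have "\<dots> = {z. far D z}"
        by (rule Set.set_eqI) (auto simp: far_def split_beta ball_Un simp del: of_nat_Suc)
      finally show "closedin K {z. far D z}" .
    next
      fix J assume J: "finite J" "J \<subseteq> \<C>"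
      show "\<exists>z\<in>topspace K. \<forall>D\<in>J. z \<in> {z. far D z}"
      proof (cases "J = {}")
        case True
        then show ?thesis using x by auto
      next
        case False
        have "subset.chain \<D> J"
          using \<C>(2) J(2) unfolding subset.chain_def by blast
        then have "\<Union>J \<in> J"
          using False J(1) by (simp add: Union_in_chain)
        then have "\<Union>J \<in> \<D>"
          using \<C>(2) J(2) unfolding subset.chain_def by blast
        then obtain z where "far (\<Union>J) z"
          by (auto simp: \<D>_def)
        then have "z \<in> topspace K" "\<forall>D\<in>J. far D z"
          unfolding far_def by blast+
        then show ?thesis by blast
      qed
    qed
    then obtain z where "\<forall>D\<in>\<C>. far D z"
      by blast
    then have "far (\<Union>\<C>) z"
      using \<C>(1) unfolding far_def by blast
    then show "\<Union>\<C> \<in> \<D>"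
      unfolding \<D>_def by blast
  qed
  then obtain D where D: "D \<in> \<D>" "\<forall>X\<in>\<D>. D \<subseteq> X \<longrightarrow> X = D"
    by (elim bexE)
  then obtain z where "far D z"
    unfolding \<D>_def by blast
  then have z: "z \<in> topspace K" "\<forall>\<gamma>\<in>N. f \<gamma> z = f \<gamma> x"
    and far_z: "\<And>\<gamma> n. (\<gamma>, n) \<in> D \<Longrightarrow> 1 / real (Suc n) \<le> \<bar>f \<gamma> z - f \<gamma> x\<bar>"
    unfolding far_def by blast+
  define M where "M = N \<union> fst ` D"
  \<comment> \<open>Where \<open>z\<close> differs from \<open>x\<close>, at least one of the two is
    nonzero.\<close>
  have "fst ` D \<subseteq> {\<gamma>. f \<gamma> z \<noteq> 0} \<union> {\<gamma>. f \<gamma> x \<noteq> 0}"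
  proof safe
    fix \<gamma> n assume "(\<gamma>, n) \<in> D" and *: "f (fst (\<gamma>, n)) x = 0" "f (fst (\<gamma>, n)) z = 0"
    with far_z[of \<gamma> n] have "1 / real (Suc n) \<le> 0"
      by simp
    then show False by simp
  qed
  moreover have "|{\<gamma>. f \<gamma> z \<noteq> 0} \<union> {\<gamma>. f \<gamma> x \<noteq> 0}| <o \<kappa>"
    using card_of_Un_ordLess_infinite_Field[OF infinite_kappa Card support support] z(1) x by blast
  ultimately have "|fst ` D| <o \<kappa>"
    using card_of_mono1 ordLeq_ordLess_trans by blast
  then have "|M| <o \<kappa>"
    unfolding M_def using card_of_Un_ordLess_infinite_Field[OF infinite_kappa Card N(1)] by blast
  then obtain y \<gamma> n where y: "y \<in> topspace K" "\<forall>\<delta>\<in>M. f \<delta> y = f \<delta> z" "\<gamma> \<notin> M"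
      "1 / real (Suc n) \<le> \<bar>f \<gamma> y - f \<gamma> x\<bar>"
    using N(2)[rule_format, of M z] z by (auto simp: M_def)
  have "f \<delta> y = f \<delta> z" if "(\<delta>, k) \<in> D" for \<delta> k
    using y(2) that by (force simp: M_def)
  then have "far (insert (\<gamma>, n) D) y"
    unfolding far_def using y(1,2,4) z(2) far_z by (auto simp: M_def simp del: of_nat_Suc)
  then have "insert (\<gamma>, n) D = D"
    using D(2) unfolding \<D>_def by blast
  then have "\<gamma> \<in> M"
    unfolding M_def by force
  with y(3) show False ..
qed

text \<open>Strong tightness applies the pi-base result to the closure of a set instead of the whole
  space.\<close>

lemma small_support_coordinates_closed:
  assumes "closedin K L"
  shows "small_support_coordinates (subtopology K L) f \<kappa>"
proof
  show "compact_space (subtopology K L)"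
    using assms compact closedin_compact_space compact_space_subtopology by blast
qed (use cont Card uncountable support separating in \<open>auto intro: continuous_map_from_subtopology\<close>)

end

section \<open>Corson compacta and strong tightness\<close>

lemma kappa_Corson_compact_coordinates:
  fixes \<kappa> :: "'k rel" and K :: "'a topology"
  assumes "Card_order \<kappa>" and "natLeq <o \<kappa>"
    and "kappa_Corson_compact TYPE('g) \<kappa> K"
  obtains f :: "'g \<Rightarrow> 'a \<Rightarrow> real" where "small_support_coordinates K f \<kappa>"
proof -
  obtain \<Gamma> :: "'g set" and S where S: "S \<subseteq> topspace (Sigma_topology \<kappa> \<Gamma>)"
      "K homeomorphic_space subtopology (Sigma_topology \<kappa> \<Gamma>) S" and compact: "compact_space K"
    using assms(3) unfolding kappa_Corson_compact_def by blast
  obtain h where h: "homeomorphic_map K (subtopology (Sigma_topology \<kappa> \<Gamma>) S) h"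
    using S(2) unfolding homeomorphic_space by blast
  have "continuous_map K (subtopology (Sigma_topology \<kappa> \<Gamma>) S) h"
    using h homeomorphic_imp_continuous_map by blast
  then have cont: "continuous_map K (powertop_real \<Gamma>) h"
    and supp: "\<And>y. y \<in> topspace K \<Longrightarrow> |{\<gamma> \<in> \<Gamma>. h y \<gamma> \<noteq> 0}| <o \<kappa>"
    unfolding Sigma_topology_def by (auto simp: continuous_map_in_subtopology)
  have inj: "inj_on h (topspace K)"
    using h homeomorphic_imp_injective_map by blast
  show ?thesis
  \<comment> \<open>Points of the product are \<open>undefined\<close> outside
    \<open>\<Gamma>\<close>, a value that need not be 0. Substituting 0 there keeps the supports
    small, and extensionality still recovers the point from its coordinates.\<close>
  proof (rule that[of "\<lambda>\<gamma> y. if \<gamma> \<in> \<Gamma> then h y \<gamma> else 0"], unfold_locales)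
    show "continuous_map K euclideanreal (\<lambda>y. if \<gamma> \<in> \<Gamma> then h y \<gamma> else 0)" for \<gamma>
      using cont by (auto simp: continuous_map_componentwise)
    show "y = z" if yz: "y \<in> topspace K" "z \<in> topspace K"
      and eq: "\<And>\<gamma>. (if \<gamma> \<in> \<Gamma> then h y \<gamma> else 0) = (if \<gamma> \<in> \<Gamma> then h z \<gamma> else 0)" for y z
    proof (rule inj_onD[OF inj _ yz], rule extensionalityI)
      show "h y \<in> extensional \<Gamma>" "h z \<in> extensional \<Gamma>"
        using cont yz by (auto simp: continuous_map_componentwise)
      show "h y \<gamma> = h z \<gamma>" if "\<gamma> \<in> \<Gamma>" for \<gamma>
        using eq[of \<gamma>] that by simp
    qed
    show "|{\<gamma>. (if \<gamma> \<in> \<Gamma> then h y \<gamma> else 0) \<noteq> 0}| <o \<kappa>" if "y \<in> topspace K" for y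
    proof -
      have "{\<gamma>. (if \<gamma> \<in> \<Gamma> then h y \<gamma> else 0) \<noteq> 0} = {\<gamma> \<in> \<Gamma>. h y \<gamma> \<noteq> 0}"
        by auto
      then show ?thesis using supp[OF that] by simp
    qed
  qed (use assms compact in auto)
qed

text \<open>In its closure \<open>L\<close> the set \<open>X\<close> is dense, so every member of a
  local pi-base of \<open>L\<close> meets \<open>X\<close>; a nonempty open subset of
  \<open>K\<close> might miss it. One chosen point per member accumulates at
  \<open>x\<close>.\<close>

lemma (in small_support_coordinates) strong_tightness:
  assumes sing: "\<not> regularCard \<kappa>"
  shows "strong_tightness_le K \<kappa>"
  unfolding strong_tightness_le_def
proof (intro allI impI)
  fix X x assume "X \<subseteq> topspace K \<and> x \<in> K closure_of X"
  then have X: "X \<subseteq> topspace K" and x: "x \<in> K closure_of X" by auto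
  define L where "L = subtopology K (K closure_of X)"
  interpret L: small_support_coordinates L f \<kappa>
    unfolding L_def by (rule small_support_coordinates_closed) simp
  have "x \<in> topspace L"
    using x closure_of_subset_topspace by (fastforce simp: L_def)
  then obtain \<B> where \<B>: "local_pi_base L x \<B>" "|\<B>| <o \<kappa>"
    using L.small_local_pi_base[OF sing] by blast
  have "\<exists>a. a \<in> X \<inter> V" if "V \<in> \<B>" for V
  proof -
    have "openin L V" "V \<noteq> {}"
      using \<B>(1) \<open>V \<in> \<B>\<close> unfolding local_pi_base_def by simp_all
    then obtain W where W: "openin K W" "V = W \<inter> K closure_of X" "V \<noteq> {}"
      by (auto simp: L_def openin_subtopology)
    then have "W \<inter> X \<noteq> {}"
      using openin_Int_closure_of_eq_empty[OF W(1)] by blast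
    then show ?thesis
      using W(2) closure_of_subset[OF X] by blast
  qed
  then obtain a where a: "\<And>V. V \<in> \<B> \<Longrightarrow> a V \<in> X \<inter> V"
    by metis
  show "\<exists>A\<subseteq>X. |A| <o \<kappa> \<and> x \<in> K closure_of A"
  proof (intro exI[of _ "a ` \<B>"] conjI)
    show "a ` \<B> \<subseteq> X"
      using a by blast
    show "|a ` \<B>| <o \<kappa>"
      using \<B>(2) card_of_image ordLeq_ordLess_trans by blast
    show "x \<in> K closure_of (a ` \<B>)"
      unfolding in_closure_of
    proof (intro conjI allI impI)
      show "x \<in> topspace K"
        using x by (simp add: in_closure_of)
      fix U assume U: "x \<in> U \<and> openin K U"
      then have "openin L (U \<inter> K closure_of X)"
        by (auto simp: L_def openin_subtopology)
      then obtain V where "V \<in> \<B>" "V \<subseteq> U \<inter> K closure_of X"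
        using \<B>(1) U x unfolding local_pi_base_def by blast
      then show "\<exists>y. y \<in> a ` \<B> \<and> y \<in> U"
        using a by blast
    qed
  qed
qed

theorem theorem7p5:
  fixes \<kappa> :: "'k rel" and K :: "'a topology"
  assumes "Card_order \<kappa>" and "natLeq <o \<kappa>" and "\<not> regularCard \<kappa>"
    and "kappa_Corson_compact TYPE('g) \<kappa> K"
  shows "(\<forall>x \<in> topspace K. pi_character x K <o \<kappa>) \<and> strong_tightness_le K \<kappa>"
proof -
  obtain f :: "'g \<Rightarrow> 'a \<Rightarrow> real" where "small_support_coordinates K f \<kappa>"
    using kappa_Corson_compact_coordinates[OF assms(1,2,4)] .
  then interpret small_support_coordinates K f \<kappa> .
  have "pi_character x K <o \<kappa>" if x: "x \<in> topspace K" for x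
  proof -
    obtain \<B> where "local_pi_base K x \<B>" "|\<B>| <o \<kappa>"
      using small_local_pi_base[OF assms(3) x] by blast
    then show ?thesis
      by (rule ordLeq_ordLess_trans[OF pi_character_least])
  qed
  with strong_tightness[OF assms(3)] show ?thesis
    by simp
qed

end
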